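(* Let $(X,\|\cdot\|_X,\tau_X)$ be a sequentially complete Saks space, $(S_t)_{t\geq 0}$ a locally $\tau_X$-bi-continuous semigroup on $X$, $(Y,\|\cdot\|_Y,\tau_Y)$ a Saks space, and $C\in\mathcal{L}(X;Y)$ such that $C$ is also sequentially $\tau_X$-$\tau_Y$-continuous on $\|\cdot\|_X$-bounded sets. Further, let $\lambda^*\geq 0$, $(P_\lambda)_{\lambda>\lambda^*}$ a family in $\mathcal{L}(X)$, $r\in[1,\infty]$, $d_0,d_1,d_3,\gamma_1,\gamma_2,\gamma_3,T>0$ with $\gamma_1<\gamma_2$, and $d_2\geq 1$, and assume that $$\forall x\in X\ \forall \lambda>\lambda^*:\quad \|P_\lambda x\|_X\leq d_0 e^{d_1\lambda^{\gamma_1}}\|CP_\lambda x\|_Y$$ and $$\forall x\in X\ \forall\lambda>\lambda^*\ \forall t\in(0,T/2]:\quad \|(I-P_\lambda)S_tx\|_X\leq d_2 e^{-d_3\lambda^{\gamma_2}t^{\gamma_3}}\|x\|_X.$$ Then there exists $C_{\mathrm{obs}}\geq 0$ such that for all $x\in X$ we have $$\|S_Tx\|_X\leq\begin{cases} C_{\mathrm{obs}}\left(\int_0^T\|CS_tx\|_Y^r\,\mathrm{d}t\right)^{1/r} & \text{if } r\in[1,\infty),\\ C_{\mathrm{obs}}\,\operatorname{ess\,sup}_{t\in[0,T]}\|CS_tx\|_Y & \text{if } r=\infty.\end{cases}$$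
   Context: All vector spaces are over $\mathbb{R}$ or $\mathbb{C}$. $\mathcal{L}(X;Y)$ denotes the space of norm-continuous linear operators between Banach spaces $X$ and $Y$, and $\mathcal{L}(X):=\mathcal{L}(X;X)$. A triple $(X,\|\cdot\|_X,\tau_X)$, with $(X,\|\cdot\|_X)$ a normed space and $\tau_X$ a Hausdorff locally convex topology on $X$, is a Saks space if $(X,\|\cdot\|_X)$ is a Banach space, $\tau_X$ is coarser than (or equal to) the $\|\cdot\|_X$-topology, and the topological dual $(X,\tau_X)'$ is norming for $X$, i.e. $\|x\|_X=\sup\{|\langle x',x\rangle| : x'\in(X,\tau_X)',\ \|x'\|_{X'}\leq 1\}$ for all $x\in X$. The mixed topology $\gamma_X$ is the finest linear topology on $X$ that coincides with $\tau_X$ on $\|\cdot\|_X$-bounded sets and lies between $\tau_X$ and the $\|\cdot\|_X$-topology. The Saks space is sequentially complete if $(X,\gamma_X)$ is sequentially complete (equivalently, every $\|\cdot\|_X$-bounded $\tau_X$-Cauchy sequence $\tau_X$-converges in $X$). A semigroup on $X$ is a family $(S_t)_{t\geq 0}$ in $\mathcal{L}(X)$ with $S_0=I$, $S_{t+s}=S_tS_s$ for $t,s\geq 0$. It is locally $\tau_X$-bi-continuous if (i) there are $M\geq 1$, $\omega\in\mathbb{R}$ with $\|S_t\|_{\mathcal{L}(X)}\leq Me^{\omega t}$ for all $t\geq 0$; (ii) for all $x\in X$ the map $[0,\infty)\ni t\mapsto S_tx\in(X,\tau_X)$ is continuous; (iii) for every $\|\cdot\|_X$-bounded sequence $(x_n)$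 in $X$ that $\tau_X$-converges to some $x\in X$ one has $\tau_X\text{-}\lim_{n\to\infty}S_t(x_n-x)=0$ locally uniformly for $t\in[0,\infty)$. A linear map $C:X\to Y$ is sequentially $\tau_X$-$\tau_Y$-continuous on $\|\cdot\|_X$-bounded sets if $Cx_n\to Cx$ in $\tau_Y$ for every $\|\cdot\|_X$-bounded sequence $(x_n)$ that $\tau_X$-converges to some $x\in X$. *)

theory Defs
  imports "HOL-Analysis.Analysis" "HOL-Probability.Essential_Supremum"
begin

text \<open>
  Scalars are elements of an arbitrary type \<open>'k\<close> of class \<open>real_normed_field\<close>. By the
  Gelfand--Mazur theorem such a field is, up to isometric isomorphism, either the reals or the
  complex numbers, so this is a uniform way of saying ``over the reals or the complex numbers''.
  Since the class \<open>banach\<close> only provides the real scalar multiplication, the multiplication by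
  elements of \<open>'k\<close> is an explicit function \<open>s\<close> that extends it. A type of class \<open>banach\<close>
  together with such an \<open>s\<close> is a Banach space over \<open>'k\<close>.
\<close>

definition normed_scaling :: "('k::real_normed_field \<Rightarrow> 'a::real_normed_vector \<Rightarrow> 'a) \<Rightarrow> bool" where
  "normed_scaling s \<longleftrightarrow>
     vector_space s \<and>
     (\<forall>a x. s (of_real a) x = a *\<^sub>R x) \<and>
     (\<forall>c x. norm (s c x) = norm c * norm x)"

definition bounded_operators ::
    "('k::real_normed_field \<Rightarrow> 'a::real_normed_vector \<Rightarrow> 'a) \<Rightarrow>
     ('k \<Rightarrow> 'b::real_normed_vector \<Rightarrow> 'b) \<Rightarrow> ('a \<Rightarrow> 'b) set" where
  "bounded_operators sX sY = {A. Vector_Spaces.linear sX sY A \<and> bounded_linear A}"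

definition linear_topology ::
    "('k::real_normed_field \<Rightarrow> 'a::ab_group_add \<Rightarrow> 'a) \<Rightarrow> 'a topology \<Rightarrow> bool" where
  "linear_topology s \<tau> \<longleftrightarrow>
     topspace \<tau> = UNIV \<and>
     continuous_map (prod_topology \<tau> \<tau>) \<tau> (\<lambda>(x, y). x + y) \<and>
     continuous_map (prod_topology euclidean \<tau>) \<tau> (\<lambda>(c, x). s c x)"

definition locally_convex_topology ::
    "('k::real_normed_field \<Rightarrow> 'a::real_vector \<Rightarrow> 'a) \<Rightarrow> 'a topology \<Rightarrow> bool" where
  "locally_convex_topology s \<tau> \<longleftrightarrow>
     linear_topology s \<tau> \<and>
     (\<forall>U. openin \<tau> U \<and> 0 \<in> U \<longrightarrow> (\<exists>V. openin \<tau> V \<and> convex V \<and> 0 \<in> V \<and> V \<subseteq> U))"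

definition coarser_eq :: "'a topology \<Rightarrow> 'a topology \<Rightarrow> bool" where
  "coarser_eq \<sigma> \<tau> \<longleftrightarrow> (\<forall>U. openin \<sigma> U \<longrightarrow> openin \<tau> U)"

definition topological_dual ::
    "('k::real_normed_field \<Rightarrow> 'a::ab_group_add \<Rightarrow> 'a) \<Rightarrow> 'a topology \<Rightarrow> ('a \<Rightarrow> 'k) set" where
  "topological_dual s \<tau> = {f. Vector_Spaces.linear s (*) f \<and> continuous_map \<tau> euclidean f}"

text \<open>
  The norm of a Saks space is that of the class \<open>banach\<close>. Elements of the dual with respect to a
  topology that is coarser than the norm topology are norm-bounded, so that \<open>onorm\<close> is their
  dual norm, and the supremum below is one of a nonempty bounded set.
\<close>

definition saks_space :: "('k::real_normed_field \<Rightarrow> 'a::banach \<Rightarrow> 'a) \<Rightarrow> 'a topology \<Rightarrow> bool" where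
  "saks_space s \<tau> \<longleftrightarrow>
     normed_scaling s \<and>
     locally_convex_topology s \<tau> \<and>
     Hausdorff_space \<tau> \<and>
     coarser_eq \<tau> euclidean \<and>
     (\<forall>x. norm x = (SUP f\<in>{f \<in> topological_dual s \<tau>. onorm f \<le> 1}. norm (f x)))"

definition mixed_candidate ::
    "('k::real_normed_field \<Rightarrow> 'a::real_normed_vector \<Rightarrow> 'a) \<Rightarrow> 'a topology \<Rightarrow> 'a topology \<Rightarrow> bool" where
  "mixed_candidate s \<tau> \<sigma> \<longleftrightarrow>
     linear_topology s \<sigma> \<and>
     coarser_eq \<tau> \<sigma> \<and> coarser_eq \<sigma> euclidean \<and>
     (\<forall>B. bounded B \<longrightarrow> subtopology \<sigma> B = subtopology \<tau> B)"

definition mixed_topology ::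
    "('k::real_normed_field \<Rightarrow> 'a::real_normed_vector \<Rightarrow> 'a) \<Rightarrow> 'a topology \<Rightarrow> 'a topology" where
  "mixed_topology s \<tau> =
     (THE \<gamma>. mixed_candidate s \<tau> \<gamma> \<and> (\<forall>\<sigma>. mixed_candidate s \<tau> \<sigma> \<longrightarrow> coarser_eq \<sigma> \<gamma>))"

text \<open>The finest topology in the definition of \<open>mixed_topology\<close> exists, so it is well-defined.\<close>

lemma mixed_topology_finest:
  fixes s :: "'k::real_normed_field \<Rightarrow> 'a::real_normed_vector \<Rightarrow> 'a"
  assumes lin: "linear_topology s \<tau>" and coarse: "coarser_eq \<tau> euclidean"
  shows "mixed_candidate s \<tau> (mixed_topology s \<tau>)"
    and "\<And>\<sigma>. mixed_candidate s \<tau> \<sigma> \<Longrightarrow> coarser_eq \<sigma> (mixed_topology s \<tau>)"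
proof -
  define G where "G = {U. \<exists>\<sigma>. mixed_candidate s \<tau> \<sigma> \<and> openin \<sigma> U}"
  define \<gamma> where "\<gamma> = topology_generated_by G"
  have cand_\<tau>: "mixed_candidate s \<tau> \<tau>"
    using assms by (simp add: mixed_candidate_def coarser_eq_def)
  have finest: "coarser_eq \<sigma> \<gamma>" if "mixed_candidate s \<tau> \<sigma>" for \<sigma>
    using that unfolding coarser_eq_def \<gamma>_def G_def
    by (auto intro!: topology_generated_by_Basis)
  have "openin \<tau> UNIV"
    using lin unfolding linear_topology_def by (metis openin_topspace)
  then have top: "topspace \<gamma> = UNIV"
    using cand_\<tau> unfolding \<gamma>_def topology_generated_by_topspace G_def by blast
  have into: "continuous_map T \<gamma> f"
    if "topspace T = UNIV" "\<And>\<sigma>. mixed_candidate s \<tau> \<sigma> \<Longrightarrow> continuous_map T \<sigma> f"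
    for T :: "'z topology" and f
    unfolding \<gamma>_def
  proof (rule continuous_on_generated_topo)
    show "openin T (f -` U \<inter> topspace T)" if "U \<in> G" for U
    proof -
      from \<open>U \<in> G\<close> obtain \<sigma> where \<sigma>: "mixed_candidate s \<tau> \<sigma>" "openin \<sigma> U"
        by (auto simp: G_def)
      have "openin T {x \<in> topspace T. f x \<in> U}"
        by (rule openin_continuous_map_preimage[OF \<open>\<And>\<sigma>. mixed_candidate s \<tau> \<sigma> \<Longrightarrow> continuous_map T \<sigma> f\<close>[OF \<sigma>(1)] \<sigma>(2)])
      then show ?thesis by (simp add: vimage_def Int_def conj_commute)
    qed
    show "f ` topspace T \<subseteq> \<Union>G"
      using top unfolding \<gamma>_def topology_generated_by_topspace by simp
  qed
  have id: "continuous_map \<gamma> \<sigma> (\<lambda>x. x)" if "mixed_candidate s \<tau> \<sigma>" for \<sigma>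
    using finest[OF that] that top
    by (auto simp: continuous_map_def coarser_eq_def mixed_candidate_def linear_topology_def)
  have add: "continuous_map (prod_topology \<gamma> \<gamma>) \<gamma> (\<lambda>(x, y). x + y)"
  proof (rule into)
    fix \<sigma> assume \<sigma>: "mixed_candidate s \<tau> \<sigma>"
    have "continuous_map (prod_topology \<gamma> \<gamma>) (prod_topology \<sigma> \<sigma>) (\<lambda>(x, y). (x, y))"
      using id[OF \<sigma>] unfolding continuous_map_prod_top by blast
    moreover have "continuous_map (prod_topology \<sigma> \<sigma>) \<sigma> (\<lambda>(x, y). x + y)"
      using \<sigma> by (simp add: mixed_candidate_def linear_topology_def)
    ultimately show "continuous_map (prod_topology \<gamma> \<gamma>) \<sigma> (\<lambda>(x, y). x + y)"
      using continuous_map_compose by (fastforce simp: o_def case_prod_beta)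
  qed (simp add: top)
  have scale: "continuous_map (prod_topology euclidean \<gamma>) \<gamma> (\<lambda>(c, x). s c x)"
  proof (rule into)
    fix \<sigma> assume \<sigma>: "mixed_candidate s \<tau> \<sigma>"
    have "continuous_map (prod_topology (euclidean :: 'k topology) \<gamma>)
            (prod_topology euclidean \<sigma>) (\<lambda>(x, y). (x, y))"
      using id[OF \<sigma>] unfolding continuous_map_prod_top by (simp add: continuous_map_id[unfolded id_def])
    moreover have "continuous_map (prod_topology euclidean \<sigma>) \<sigma> (\<lambda>(c, x). s c x)"
      using \<sigma> by (simp add: mixed_candidate_def linear_topology_def)
    ultimately show "continuous_map (prod_topology euclidean \<gamma>) \<sigma> (\<lambda>(c, x). s c x)"
      using continuous_map_compose by (fastforce simp: o_def case_prod_beta)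
  qed (simp add: top)
  have norm: "coarser_eq \<gamma> euclidean"
  proof -
    have "continuous_map euclidean \<gamma> (\<lambda>x. x)"
      by (rule into)
        (auto simp: continuous_map_def mixed_candidate_def coarser_eq_def linear_topology_def)
    then show ?thesis
      unfolding coarser_eq_def continuous_map_def using top by simp
  qed
  have sub: "subtopology \<gamma> B = subtopology \<tau> B" if B: "bounded B" for B
  proof -
    have "continuous_map (subtopology \<tau> B) \<gamma> (\<lambda>x. x)"
      unfolding \<gamma>_def
    proof (rule continuous_on_generated_topo)
      fix U assume "U \<in> G"
      then obtain \<sigma> where \<sigma>: "mixed_candidate s \<tau> \<sigma>" "openin \<sigma> U"
        by (auto simp: G_def)
      have "openin (subtopology \<sigma> B) (U \<inter> B)"
        using \<sigma>(2) by (auto simp: openin_subtopology)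
      then have "openin (subtopology \<tau> B) (U \<inter> B)"
        using \<sigma>(1) B unfolding mixed_candidate_def by simp
      moreover have "(\<lambda>x. x) -` U \<inter> topspace (subtopology \<tau> B) = U \<inter> B"
        using lin by (auto simp: linear_topology_def)
      ultimately show "openin (subtopology \<tau> B) ((\<lambda>x. x) -` U \<inter> topspace (subtopology \<tau> B))"
        by simp
    next
      show "(\<lambda>x. x) ` topspace (subtopology \<tau> B) \<subseteq> \<Union>G"
        using top unfolding \<gamma>_def topology_generated_by_topspace by simp
    qed
    then have 1: "openin (subtopology \<tau> B) (U \<inter> B)" if "openin \<gamma> U" for U
      using openin_continuous_map_preimage[OF _ that, of "subtopology \<tau> B" "\<lambda>x. x"] lin
      by (simp add: linear_topology_def Int_def conj_commute)
    show ?thesis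
      unfolding topology_eq
    proof (intro allI iffI)
      fix V assume "openin (subtopology \<gamma> B) V"
      then show "openin (subtopology \<tau> B) V"
        using 1 by (auto simp: openin_subtopology[of \<gamma>])
    next
      fix V assume "openin (subtopology \<tau> B) V"
      then show "openin (subtopology \<gamma> B) V"
        using finest[OF cand_\<tau>] by (auto simp: openin_subtopology coarser_eq_def)
    qed
  qed
  have cand: "mixed_candidate s \<tau> \<gamma>"
    using top add scale norm sub finest[OF cand_\<tau>]
    by (simp add: mixed_candidate_def linear_topology_def)
  have "mixed_topology s \<tau> = \<gamma>"
    unfolding mixed_topology_def
  proof (rule the_equality)
    show "mixed_candidate s \<tau> \<gamma> \<and> (\<forall>\<sigma>. mixed_candidate s \<tau> \<sigma> \<longrightarrow> coarser_eq \<sigma> \<gamma>)"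
      using cand finest by blast
  next
    fix \<gamma>' assume "mixed_candidate s \<tau> \<gamma>' \<and> (\<forall>\<sigma>. mixed_candidate s \<tau> \<sigma> \<longrightarrow> coarser_eq \<sigma> \<gamma>')"
    then show "\<gamma>' = \<gamma>"
      using cand finest unfolding topology_eq coarser_eq_def by blast
  qed
  then show "mixed_candidate s \<tau> (mixed_topology s \<tau>)"
    and "\<And>\<sigma>. mixed_candidate s \<tau> \<sigma> \<Longrightarrow> coarser_eq \<sigma> (mixed_topology s \<tau>)"
    using cand finest by simp_all
qed

definition Cauchy_in :: "'a::ab_group_add topology \<Rightarrow> (nat \<Rightarrow> 'a) \<Rightarrow> bool" where
  "Cauchy_in \<tau> xs \<longleftrightarrow>
     (\<forall>U. openin \<tau> U \<and> 0 \<in> U \<longrightarrow> (\<exists>N. \<forall>m\<ge>N. \<forall>n\<ge>N. xs m - xs n \<in> U))"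

definition seq_complete_saks_space ::
    "('k::real_normed_field \<Rightarrow> 'a::banach \<Rightarrow> 'a) \<Rightarrow> 'a topology \<Rightarrow> bool" where
  "seq_complete_saks_space s \<tau> \<longleftrightarrow>
     saks_space s \<tau> \<and>
     (\<forall>xs. Cauchy_in (mixed_topology s \<tau>) xs \<longrightarrow>
        (\<exists>x. limitin (mixed_topology s \<tau>) xs x sequentially))"

text \<open>Semigroups are indexed by all reals, but only their members for \<open>t \<ge> 0\<close> matter.\<close>

definition operator_semigroup ::
    "('k::real_normed_field \<Rightarrow> 'a::real_normed_vector \<Rightarrow> 'a) \<Rightarrow> (real \<Rightarrow> 'a \<Rightarrow> 'a) \<Rightarrow> bool" where
  "operator_semigroup s S \<longleftrightarrow>
     (\<forall>t\<ge>0. S t \<in> bounded_operators s s) \<and>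
     S 0 = id \<and>
     (\<forall>t\<ge>0. \<forall>u\<ge>0. S (t + u) = S t \<circ> S u)"

definition locally_bicontinuous_semigroup ::
    "('k::real_normed_field \<Rightarrow> 'a::real_normed_vector \<Rightarrow> 'a) \<Rightarrow> 'a topology \<Rightarrow>
     (real \<Rightarrow> 'a \<Rightarrow> 'a) \<Rightarrow> bool" where
  "locally_bicontinuous_semigroup s \<tau> S \<longleftrightarrow>
     operator_semigroup s S \<and>
     (\<exists>M\<ge>1. \<exists>\<omega>. \<forall>t\<ge>0. onorm (S t) \<le> M * exp (\<omega> * t)) \<and>
     (\<forall>x. continuous_map (top_of_set {0..}) \<tau> (\<lambda>t. S t x)) \<and>
     (\<forall>xs x. bounded (range xs) \<and> limitin \<tau> xs x sequentially \<longrightarrow>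
        (\<forall>b\<ge>0. \<forall>U. openin \<tau> U \<and> 0 \<in> U \<longrightarrow>
           (\<forall>\<^sub>F n in sequentially. \<forall>t\<in>{0..b}. S t (xs n - x) \<in> U)))"

definition seq_continuous_on_bounded ::
    "'a::real_normed_vector topology \<Rightarrow> 'b topology \<Rightarrow> ('a \<Rightarrow> 'b) \<Rightarrow> bool" where
  "seq_continuous_on_bounded \<tau>X \<tau>Y C \<longleftrightarrow>
     (\<forall>xs x. bounded (range xs) \<and> limitin \<tau>X xs x sequentially \<longrightarrow>
        limitin \<tau>Y (\<lambda>n. C (xs n)) (C x) sequentially)"

end

theory Submission
  imports Defs "HOL-Real_Asymp.Real_Asymp"
begin

text \<open>
  Uncertainty and dissipation together give
  \<open>\<parallel>S\<^sub>t y\<parallel> \<le> d\<^sub>0 exp(d\<^sub>1 \<mu>) \<parallel>C S\<^sub>t y\<parallel> + b exp(d\<^sub>1 \<mu> - d\<^sub>3 \<mu>\<^sup>\<beta> t\<^sup>\<gamma>) \<parallel>y\<parallel>\<close>, where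
  \<open>\<mu> = \<lambda>\<^bsup>\<gamma>\<^sub>1\<^esup>\<close>, \<open>\<beta> = \<gamma>\<^sub>2/\<gamma>\<^sub>1 > 1\<close> and \<open>\<gamma> = \<gamma>\<^sub>3\<close>. This is averaged over the second halves of time
  intervals whose lengths decay like \<open>\<rho>\<^sup>k\<close>, with \<open>\<mu>\<^sub>k = R 2\<^sup>k\<close> on the \<open>k\<close>-th one. The ratio \<open>\<rho>\<close> is
  chosen such that the dissipation exponent also grows exactly like \<open>2\<^sup>k\<close>, and \<open>R\<close> such that
  dissipation wins; weighted by \<open>exp(-(d\<^sub>1 + 1) \<mu>\<^sub>k)\<close>, the estimates telescope to a bound of
  \<open>\<parallel>S\<^sub>T x\<parallel>\<close> by the \<open>L\<^sup>1\<close>-norm of \<open>t \<mapsto> \<parallel>C S\<^sub>t x\<parallel>\<close>. The latter function is only known to be lower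
  semicontinuous, which suffices for measurability.
\<close>


section \<open>Telescoping estimate for real functions\<close>

text \<open>Integrate the pointwise bound over \<open>{p..q}\<close> and, as \<open>g\<close> is
  nonnegative, enlarge the domain of its integral to \<open>{a..q}\<close>. Expressing the result by
  integrals starting at \<open>0\<close> lets successive estimates telescope.\<close>

lemma integral_lower_bound:
  fixes g :: "real \<Rightarrow> real"
  assumes g: "g integrable_on {0..q}" "\<And>s. s \<in> {0..q} \<Longrightarrow> 0 \<le> g s"
    and apq: "0 \<le> a" "a \<le> p" "p \<le> q" and A: "0 \<le> A"
    and le: "\<And>s. s \<in> {p..q} \<Longrightarrow> c \<le> A * g s + B"
  shows "(q - p) * c \<le> A * (integral {0..q} g - integral {0..a} g) + (q - p) * B"
proof -
  have int: "g integrable_on {u..v}" if "0 \<le> u" "v \<le> q" for u v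
    using integrable_on_subinterval[OF g(1)] that by auto
  have "integral {p..q} (\<lambda>_. c) \<le> integral {p..q} (\<lambda>s. A * g s + B)"
    using le int[of p q] apq
    by (intro integral_le integrable_add) (auto intro!: integrable_on_mult_right)
  also have "\<dots> = A * integral {p..q} g + (q - p) * B"
    using int[of p q] apq by (subst integral_add) (auto intro!: integrable_on_mult_right)
  finally have "(q - p) * c \<le> A * integral {p..q} g + (q - p) * B"
    using apq by simp
  moreover have "integral {p..q} g \<le> integral {a..q} g"
    using apq by (intro integral_subset_le int) (auto intro!: g(2))
  moreover have "integral {0..a} g + integral {a..q} g = integral {0..q} g"
    using apq g(1) by (intro Henstock_Kurzweil_Integration.integral_combine) auto
  ultimately have "A * integral {p..q} g \<le> A * (integral {0..q} g - integral {0..a} g)"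
    using A by (intro mult_left_mono) auto
  with \<open>(q - p) * c \<le> A * integral {p..q} g + (q - p) * B\<close> show ?thesis by linarith
qed

text \<open>The functions \<open>N\<close> and \<open>g\<close> stand for the norms of
  \<open>S t x\<close> and \<open>C (S t x)\<close>. They are quantified after \<open>K\<close>, so
  one constant serves every \<open>x\<close>.\<close>

lemma telescoping_observability:
  fixes M a b d1 d3 \<beta> \<gamma> T \<mu>0 :: real
  assumes M: "M \<ge> 1" and a: "a \<ge> 0" and b: "b \<ge> 1" and d1: "d1 \<ge> 0" and d3: "d3 > 0"
    and \<beta>: "\<beta> > 1" and \<gamma>: "\<gamma> > 0" and T: "T > 0"
  obtains K where "K \<ge> 0"
    "\<And>N g. \<lbrakk>\<And>s t. 0 \<le> s \<Longrightarrow> s \<le> t \<Longrightarrow> t \<le> T \<Longrightarrow> N t \<le> M * N s;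
        \<And>t. t \<in> {0..T} \<Longrightarrow> 0 \<le> N t; \<And>t. t \<in> {0..T} \<Longrightarrow> 0 \<le> g t; g integrable_on {0..T};
        \<And>s t \<mu>. \<lbrakk>0 \<le> s; 0 < t; t \<le> T / 2; s + t \<le> T; \<mu>0 \<le> \<mu>\<rbrakk> \<Longrightarrow>
          N (s + t) \<le> a * exp (d1 * \<mu>) * g (s + t)
            + b * exp (d1 * \<mu> - d3 * \<mu> powr \<beta> * t powr \<gamma>) * N s\<rbrakk>
      \<Longrightarrow> N T \<le> K * integral {0..T} g"
proof -
  \<comment> \<open>Chosen so that \<open>\<rho> powr \<gamma> = 2 powr (1 - \<beta>)\<close>: a
    factor \<open>2\<close> in \<open>\<mu>\<close> and a factor \<open>\<rho>\<close> in time
    together double the dissipation exponent.\<close>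
  define \<rho> :: real where "\<rho> = 2 powr (- (\<beta> - 1) / \<gamma>)"
  have \<rho>: "0 < \<rho>" "\<rho> < 1"
    using \<beta> \<gamma> unfolding \<rho>_def by (simp_all add: powr_less_one divide_neg_pos)
  \<comment> \<open>The \<open>k\<close>-th interval will have length
    \<open>2 * h * \<rho> ^ k\<close>, so \<open>h * \<rho> ^ k\<close> is half of it.\<close>
  define h where "h = T * (1 - \<rho>) / 4"
  have h: "0 < h" using T \<rho> by (simp add: h_def)
  define c where "c = d3 * h powr \<gamma>"
  have c: "0 < c" using d3 h by (simp add: c_def)
  have "\<forall>\<^sub>F R in at_top. 2 * d1 + 2 \<le> c * R powr (\<beta> - 1)"
  proof -
    have "filterlim (\<lambda>R. R powr (\<beta> - 1)) at_top at_top"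
      using \<beta> by real_asymp
    then have "filterlim (\<lambda>R. c * R powr (\<beta> - 1)) at_top at_top"
      using c filterlim_tendsto_pos_mult_at_top tendsto_const by blast
    then show ?thesis by (simp add: filterlim_at_top)
  qed
  moreover have "\<forall>\<^sub>F R in at_top. max (max 1 \<mu>0) (max (ln (M * b)) (- ln \<rho>)) \<le> R"
    by (rule eventually_ge_at_top)
  ultimately have "\<forall>\<^sub>F R in at_top. 2 * d1 + 2 \<le> c * R powr (\<beta> - 1) \<and>
      max (max 1 \<mu>0) (max (ln (M * b)) (- ln \<rho>)) \<le> R"
    by (rule eventually_conj)
  \<comment> \<open>The first inequality makes the dissipation exponent at least
    \<open>(2 * d1 + 2) * \<mu>\<close>. The bound by \<open>ln (M * b)\<close> absorbs the
    constants, and the one by \<open>- ln \<rho>\<close> pays for averaging over ever shorter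
    intervals.\<close>
  then obtain R where R_large: "2 * d1 + 2 \<le> c * R powr (\<beta> - 1)"
    and R: "1 \<le> R" "\<mu>0 \<le> R" "ln (M * b) \<le> R" "- ln \<rho> \<le> R"
    by (auto dest!: eventually_happens)
  define w where "w k = exp (- (d1 + 1) * (R * 2 ^ k))" for k :: nat
  \<comment> \<open>The points decrease from \<open>\<alpha> 0 = T\<close> towards
    \<open>T / 2\<close>; the \<open>k\<close>-th interval runs from \<open>\<alpha> (Suc k)\<close>
    to \<open>\<alpha> k\<close>. Elapsed times inside it thus stay below \<open>T / 2\<close>, as
    dissipation requires.\<close>
  define \<alpha> where "\<alpha> k = T / 2 + T / 2 * \<rho> ^ k" for k :: nat
  define W where "W = M * a / h"
  have W: "0 \<le> W" using M a h by (simp add: W_def)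
  have main: "N T \<le> W / w 0 * integral {0..T} g"
    if mono: "\<And>s t. 0 \<le> s \<Longrightarrow> s \<le> t \<Longrightarrow> t \<le> T \<Longrightarrow> N t \<le> M * N s"
      and N: "\<And>t. t \<in> {0..T} \<Longrightarrow> 0 \<le> N t" and g: "\<And>t. t \<in> {0..T} \<Longrightarrow> 0 \<le> g t"
      and int: "g integrable_on {0..T}"
      and step: "\<And>s t \<mu>. \<lbrakk>0 \<le> s; 0 < t; t \<le> T / 2; s + t \<le> T; \<mu>0 \<le> \<mu>\<rbrakk> \<Longrightarrow>
          N (s + t) \<le> a * exp (d1 * \<mu>) * g (s + t)
            + b * exp (d1 * \<mu> - d3 * \<mu> powr \<beta> * t powr \<gamma>) * N s"
    for N g :: "real \<Rightarrow> real"
  proof -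
    have \<rho>k: "0 < \<rho> ^ k" "\<rho> ^ k \<le> 1" for k
      using \<rho> by (auto simp: power_le_one)
    have \<alpha>_bounds: "T / 2 < \<alpha> k" "\<alpha> k \<le> T" for k
      using T mult_pos_pos[of "T / 2" "\<rho> ^ k"] \<rho>k(1)[of k]
        mult_left_le[OF \<rho>k(2)[of k], of "T / 2"]
      unfolding \<alpha>_def by linarith+
    have \<alpha>_diff: "\<alpha> k - \<alpha> (Suc k) = 2 * h * \<rho> ^ k" for k
      by (simp add: \<alpha>_def h_def field_simps)
    define G where "G u = integral {0..u} g" for u
    have inc: "w k * N (\<alpha> k) \<le> W * (G (\<alpha> k) - G (\<alpha> (Suc k))) + w (Suc k) * N (\<alpha> (Suc k))" for k
    proof -
      define \<mu> where "\<mu> = R * 2 ^ k"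
      define \<eta> where "\<eta> = h * \<rho> ^ k"
      have \<eta>: "0 < \<eta>" using h \<rho>k by (simp add: \<eta>_def)
      have k2: "(1::real) \<le> 2 ^ k" by simp
      have \<mu>R: "R \<le> \<mu>" using R(1) k2 mult_left_mono[of 1 "2 ^ k" R] by (simp add: \<mu>_def)
      \<comment> \<open>On the second half of the interval at least the time \<open>\<eta>\<close>
        has elapsed, so this is the dissipation exponent in the worst case.\<close>
      have exponent: "d3 * \<mu> powr \<beta> * \<eta> powr \<gamma> = c * R powr (\<beta> - 1) * \<mu>"
      proof -
        have "\<rho> powr \<gamma> = 2 powr (1 - \<beta>)"
          using \<gamma> by (simp add: \<rho>_def powr_powr)
        then have "2 powr ((1 - \<beta>) * k) = \<rho> powr (\<gamma> * k)"
          by (metis powr_powr)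
        also have "\<dots> = (\<rho> powr k) powr \<gamma>"
          by (simp only: powr_powr mult.commute)
        also have "\<rho> powr k = \<rho> ^ k"
          using \<rho> by (simp only: powr_realpow)
        finally have "(\<rho> ^ k) powr \<gamma> = 2 powr ((1 - \<beta>) * k)" by (rule sym)
        moreover have "(2 ^ k :: real) powr \<beta> = 2 powr (\<beta> * k)"
        proof -
          have "(2 ^ k :: real) powr \<beta> = (2 powr k) powr \<beta>"
            by (simp add: powr_realpow)
          then show ?thesis by (simp only: powr_powr mult.commute)
        qed
        ultimately have "d3 * \<mu> powr \<beta> * \<eta> powr \<gamma>
            = c * R powr \<beta> * (2 powr (\<beta> * k) * 2 powr ((1 - \<beta>) * k))"
          using R(1) h \<rho> by (simp add: \<mu>_def \<eta>_def powr_mult c_def)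
        also have "2 powr (\<beta> * k) * 2 powr ((1 - \<beta>) * k) = (2 ^ k :: real)"
          by (simp add: powr_add[symmetric] algebra_simps powr_realpow)
        also have "R powr \<beta> = R powr (\<beta> - 1) * R"
          using R(1) by (simp add: powr_diff)
        finally show ?thesis by (simp add: \<mu>_def)
      qed
      \<comment> \<open>Dissipation acts from \<open>\<alpha> (Suc k)\<close> to \<open>s\<close>;
        passing from \<open>s\<close> on to \<open>\<alpha> k\<close> costs the factor
        \<open>M\<close>.\<close>
      have pointwise: "N (\<alpha> k) \<le> M * a * exp (d1 * \<mu>) * g s
          + M * b * exp (d1 * \<mu> - c * R powr (\<beta> - 1) * \<mu>) * N (\<alpha> (Suc k))"
        if s: "s \<in> {\<alpha> k - \<eta>..\<alpha> k}" for s
      proof -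
        define t where "t = s - \<alpha> (Suc k)"
        have t: "\<eta> \<le> t" "t \<le> T / 2" "s = \<alpha> (Suc k) + t"
          using s \<alpha>_diff[of k] \<alpha>_bounds[of k] \<alpha>_bounds[of "Suc k"] by (auto simp: t_def \<eta>_def)
        have "c * R powr (\<beta> - 1) * \<mu> \<le> d3 * \<mu> powr \<beta> * t powr \<gamma>"
          unfolding exponent[symmetric] using t(1) \<eta> \<gamma> d3
          by (intro mult_left_mono powr_mono2) auto
        then have E: "b * exp (d1 * \<mu> - d3 * \<mu> powr \<beta> * t powr \<gamma>) * N (\<alpha> (Suc k))
            \<le> b * exp (d1 * \<mu> - c * R powr (\<beta> - 1) * \<mu>) * N (\<alpha> (Suc k))"
          using b N[of "\<alpha> (Suc k)"] \<alpha>_bounds[of "Suc k"] T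
          by (intro mult_right_mono mult_left_mono) auto
        have "N (\<alpha> k) \<le> M * N s"
          using s \<alpha>_bounds[of k] \<alpha>_bounds[of "Suc k"] t \<eta> T by (intro mono) auto
        also have "N s \<le> a * exp (d1 * \<mu>) * g s
            + b * exp (d1 * \<mu> - d3 * \<mu> powr \<beta> * t powr \<gamma>) * N (\<alpha> (Suc k))"
          unfolding t(3) using t \<eta> s \<alpha>_bounds[of k] \<alpha>_bounds[of "Suc k"] T R(2) \<mu>R
          by (intro step) auto
        also note E
        finally show ?thesis using M by (simp add: algebra_simps)
      qed
      have "(\<alpha> k - (\<alpha> k - \<eta>)) * N (\<alpha> k) \<le> M * a * exp (d1 * \<mu>) * (integral {0..\<alpha> k} g - integral {0..\<alpha> (Suc k)} g)
          + (\<alpha> k - (\<alpha> k - \<eta>)) * (M * b * exp (d1 * \<mu> - c * R powr (\<beta> - 1) * \<mu>) * N (\<alpha> (Suc k)))"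
      proof (rule integral_lower_bound)
        show "g integrable_on {0..\<alpha> k}"
          using integrable_on_subinterval[OF int] \<alpha>_bounds[of k] by auto
      qed (use \<alpha>_bounds[of k] \<alpha>_bounds[of "Suc k"] T \<eta> \<alpha>_diff[of k] M a
            in \<open>auto intro!: g pointwise simp: \<eta>_def\<close>)
      then have "\<eta> * N (\<alpha> k) \<le> M * a * exp (d1 * \<mu>) * (G (\<alpha> k) - G (\<alpha> (Suc k)))
          + \<eta> * (M * b * exp (d1 * \<mu> - c * R powr (\<beta> - 1) * \<mu>) * N (\<alpha> (Suc k)))"
        by (simp add: G_def)
      then have "N (\<alpha> k) \<le> M * a * exp (d1 * \<mu>) / \<eta> * (G (\<alpha> k) - G (\<alpha> (Suc k)))
          + M * b * exp (d1 * \<mu> - c * R powr (\<beta> - 1) * \<mu>) * N (\<alpha> (Suc k))"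
        using \<eta> by (simp add: field_simps)
      then have "w k * N (\<alpha> k) \<le> w k * (M * a * exp (d1 * \<mu>) / \<eta> * (G (\<alpha> k) - G (\<alpha> (Suc k)))
          + M * b * exp (d1 * \<mu> - c * R powr (\<beta> - 1) * \<mu>) * N (\<alpha> (Suc k)))"
        by (intro mult_left_mono) (simp_all add: w_def)
      also have "\<dots> = (w k * (M * a * exp (d1 * \<mu>) / \<eta>)) * (G (\<alpha> k) - G (\<alpha> (Suc k)))
          + (w k * (M * b * exp (d1 * \<mu> - c * R powr (\<beta> - 1) * \<mu>))) * N (\<alpha> (Suc k))"
        by (simp add: algebra_simps)
      also have "\<dots> \<le> W * (G (\<alpha> k) - G (\<alpha> (Suc k))) + w (Suc k) * N (\<alpha> (Suc k))"
      proof (intro add_mono mult_right_mono)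
        \<comment> \<open>The weight cancels \<open>exp (d1 * \<mu>)\<close> and leaves
          \<open>exp (- \<mu>)\<close>, which is at most \<open>\<rho> ^ k\<close> and so
          compensates the division by \<open>\<eta>\<close>.\<close>
        have "real k \<le> 2 ^ k" by (simp add: less_imp_le)
        then have "k * (- ln \<rho>) \<le> 2 ^ k * R"
          using R \<rho> by (intro mult_mono) (auto simp: ln_le_zero_iff)
        then have "exp (- \<mu>) \<le> exp (k * ln \<rho>)"
          by (simp add: \<mu>_def mult.commute)
        also have "\<dots> = \<rho> ^ k"
          using \<rho> by (simp add: exp_of_nat_mult)
        finally have le1: "exp (- \<mu>) / \<rho> ^ k \<le> 1" using \<rho>k by simp
        have "w k * exp (d1 * \<mu>) = exp (- \<mu>)"
          unfolding w_def \<mu>_def[symmetric] by (simp add: exp_add[symmetric] algebra_simps)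
        then have "w k * (M * a * exp (d1 * \<mu>) / \<eta>) = W * (exp (- \<mu>) / \<rho> ^ k)"
          by (simp add: W_def \<eta>_def)
        then show "w k * (M * a * exp (d1 * \<mu>) / \<eta>) \<le> W"
          using mult_left_mono[OF le1 W] by simp
      next
        have "G (\<alpha> (Suc k)) \<le> G (\<alpha> k)"
          unfolding G_def
        proof (rule integral_subset_le)
          have "0 < 2 * h * \<rho> ^ k" using h \<rho>k by simp
          then show "{0..\<alpha> (Suc k)} \<subseteq> {0..\<alpha> k}"
            using \<alpha>_diff[of k] by auto
        qed (use \<alpha>_bounds[of k] \<alpha>_bounds[of "Suc k"] T in
              \<open>auto intro!: integrable_on_subinterval[OF int] g\<close>)
        then show "0 \<le> G (\<alpha> k) - G (\<alpha> (Suc k))" by simp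
      next
        \<comment> \<open>In units of \<open>\<mu>\<close> the exponents add up to
          \<open>- (d1 + 1) + 1 + d1 - (2 * d1 + 2) = - 2 * (d1 + 1)\<close>, which is the weight at
          the doubled \<open>\<mu>\<close>.\<close>
        have "M * b = exp (ln (M * b))" using M b by simp
        also have "\<dots> \<le> exp \<mu>" using R \<mu>R by simp
        finally have "M * b \<le> exp \<mu>" .
        moreover have "(2 * d1 + 2) * \<mu> \<le> c * R powr (\<beta> - 1) * \<mu>"
          using R_large R \<mu>R by (intro mult_right_mono) auto
        ultimately have "w k * (M * b * exp (d1 * \<mu> - c * R powr (\<beta> - 1) * \<mu>))
            \<le> w k * (exp \<mu> * exp (d1 * \<mu> - (2 * d1 + 2) * \<mu>))"
          by (intro mult_left_mono mult_mono) (auto simp: w_def)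
        also have "\<dots> = w (Suc k)"
          unfolding w_def power_Suc mult.left_commute[of R] \<mu>_def[symmetric]
          by (simp add: exp_add[symmetric] algebra_simps)
        finally show "w k * (M * b * exp (d1 * \<mu> - c * R powr (\<beta> - 1) * \<mu>)) \<le> w (Suc k)" .
      next
        show "0 \<le> N (\<alpha> (Suc k))" using N \<alpha>_bounds[of "Suc k"] T by auto
      qed
      finally show ?thesis .
    qed
    have sum: "w 0 * N T \<le> W * (G T - G (\<alpha> n)) + w n * N (\<alpha> n)" for n
    proof (induction n)
      case 0 then show ?case by (simp add: \<alpha>_def)
    next
      case (Suc n) with inc[of n] show ?case by (simp add: algebra_simps)
    qed
    \<comment> \<open>The values \<open>N (\<alpha> n)\<close> are bounded by
      \<open>M * N 0\<close>, so the remainder disappears with \<open>w n\<close> in the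
      limit.\<close>
    have "w 0 * N T \<le> W * G T + w n * (M * N 0)" for n
    proof -
      have "0 \<le> G (\<alpha> n)"
        unfolding G_def using \<alpha>_bounds[of n]
        by (intro integral_nonneg integrable_on_subinterval[OF int] g) auto
      then have "W * (G T - G (\<alpha> n)) \<le> W * G T"
        using W by (simp add: mult_left_mono)
      moreover have "w n * N (\<alpha> n) \<le> w n * (M * N 0)"
        using \<alpha>_bounds[of n] T by (intro mult_left_mono mono) (auto simp: w_def)
      ultimately show ?thesis using sum[of n] by linarith
    qed
    moreover have "(\<lambda>n. W * G T + w n * (M * N 0)) \<longlonglongrightarrow> W * G T + 0 * (M * N 0)"
    proof (intro tendsto_intros)
      have "filterlim (\<lambda>n. (d1 + 1) * R * 2 ^ n) at_top sequentially"
      proof (rule filterlim_tendsto_pos_mult_at_top[OF tendsto_const])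
        show "filterlim (\<lambda>n. 2 ^ n :: real) at_top sequentially" by real_asymp
      qed (use d1 R in simp)
      then show "w \<longlonglongrightarrow> 0"
        unfolding w_def
        by (intro filterlim_compose[OF exp_at_bot])
          (simp add: filterlim_uminus_at_bot algebra_simps)
    qed
    ultimately have "w 0 * N T \<le> W * G T"
      using LIMSEQ_le_const[of _ "W * G T" "w 0 * N T"] by simp
    then show ?thesis
      by (simp add: w_def G_def field_simps)
  qed
  show thesis
  proof (rule that)
    show "0 \<le> W / w 0" using W by (simp add: w_def)
  qed (use main in blast)
qed


section \<open>Functionals and norms in Saks spaces\<close>

lemma linear_continuous_imp_bounded_linear:
  fixes f :: "'a::real_normed_vector \<Rightarrow> 'b::real_normed_vector"
  assumes f: "linear f" and cont: "continuous (at 0) f"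
  shows "bounded_linear f"
proof -
  obtain \<delta> where \<delta>: "0 < \<delta>" "\<And>x. norm x < \<delta> \<Longrightarrow> norm (f x) < 1"
    using cont[unfolded continuous_at_eps_delta, rule_format, of 1] linear_0[OF f] by auto
  have "norm (f x) \<le> norm x * (2 / \<delta>)" for x
  proof (cases "x = 0")
    case False
    have "norm (f ((\<delta> / (2 * norm x)) *\<^sub>R x)) < 1"
      using False \<delta>(1) by (intro \<delta>(2)) simp
    then show ?thesis
      using False \<delta>(1) by (simp add: linear_scale[OF f] field_simps)
  qed (simp add: linear_0[OF f])
  with f show ?thesis
    by (intro bounded_linear.intro bounded_linear_axioms.intro exI allI)
qed

text \<open>As \<tau> is coarser than the norm topology, \<tau>-continuity yields norm continuity at
  \<open>0\<close>; compatibility of \<open>s\<close> with the real scaling yields real linearity.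
  This makes \<open>onorm f\<close> a genuine bound for \<open>f\<close>.\<close>

lemma topological_dual_bounded_linear:
  assumes s: "saks_space s \<tau>" and f: "f \<in> topological_dual s \<tau>"
  shows "bounded_linear f"
proof (rule linear_continuous_imp_bounded_linear)
  have lin: "Vector_Spaces.linear s (*) f" and f_cont: "continuous_map \<tau> euclidean f"
    using f by (auto simp: topological_dual_def)
  have real: "s (of_real a) x = a *\<^sub>R x" for a x
    using s by (simp add: saks_space_def normed_scaling_def)
  show "linear f"
  proof (rule linearI)
    show "f (x + y) = f x + f y" for x y
      using lin by (simp add: Vector_Spaces.linear_iff)
    show "f (a *\<^sub>R x) = a *\<^sub>R f x" for a x
      using lin real[of a x] by (simp add: Vector_Spaces.linear_iff scaleR_conv_of_real) metis
  qed
  have "topspace \<tau> = UNIV" and "coarser_eq \<tau> euclidean"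
    using s by (auto simp: saks_space_def locally_convex_topology_def linear_topology_def)
  then have "continuous_map euclidean euclidean f"
    using f_cont by (simp add: continuous_map_def coarser_eq_def)
  then show "continuous (at 0) f"
    by (simp add: continuous_on_eq_continuous_at)
qed

text \<open>The norming property in the form that turns superlevel sets of the norm into unions. The
  real supremum needs a nonempty set bounded above: the zero functional and \<open>norm x\<close>
  provide this.\<close>

lemma saks_norm_less_iff:
  assumes s: "saks_space s \<tau>"
  shows "a < norm x \<longleftrightarrow> (\<exists>f\<in>topological_dual s \<tau>. onorm f \<le> 1 \<and> a < norm (f x))"
proof -
  let ?D = "{f \<in> topological_dual s \<tau>. onorm f \<le> 1}"
  have norming: "norm x = (SUP f\<in>?D. norm (f x))"
    using s unfolding saks_space_def by blast
  have "vector_space s"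
    using s by (simp add: saks_space_def normed_scaling_def)
  moreover have "vector_space ((*) :: 'a \<Rightarrow> 'a \<Rightarrow> 'a)"
    by unfold_locales (auto simp: algebra_simps)
  ultimately have "(\<lambda>_. 0) \<in> ?D"
    by (auto simp: topological_dual_def Vector_Spaces.linear_iff onorm_zero)
  moreover have "norm (f x) \<le> norm x" if "f \<in> ?D" for f
  proof -
    have "norm (f x) \<le> onorm f * norm x"
      using that topological_dual_bounded_linear[OF s] by (intro onorm) auto
    also have "\<dots> \<le> 1 * norm x"
      using that by (intro mult_right_mono) auto
    finally show ?thesis by simp
  qed
  ultimately have "a < (SUP f\<in>?D. norm (f x)) \<longleftrightarrow> (\<exists>f\<in>?D. a < norm (f x))"
    by (intro less_cSUP_iff) (auto intro!: bdd_aboveI2[where M = "norm x"])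
  then show ?thesis
    using norming by auto
qed

text \<open>The norm of a Saks space is a supremum of continuous functionals, so the norm of a
  continuous curve is lower semicontinuous.\<close>

lemma saks_norm_borel_measurable:
  fixes y :: "real \<Rightarrow> 'a::banach"
  assumes s: "saks_space s \<tau>" and I: "I \<in> sets borel"
    and seq: "\<And>u t. range u \<subseteq> I \<Longrightarrow> t \<in> I \<Longrightarrow> u \<longlonglongrightarrow> t \<Longrightarrow>
      limitin \<tau> (\<lambda>n. y (u n)) (y t) sequentially"
  shows "(\<lambda>t. norm (y t)) \<in> borel_measurable (restrict_space lborel I)"
  unfolding borel_measurable_iff_greater
proof
  fix a
  have "openin (top_of_set I) {t \<in> I. a < norm (f (y t))}" if "f \<in> topological_dual s \<tau>" for f
  proof -
    have f: "continuous_map \<tau> euclidean f"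
      using that by (simp add: topological_dual_def)
    have "continuous_on I (\<lambda>t. norm (f (y t)))"
      \<comment> \<open>The domain is a subset of the real line, hence metrizable, so sequences
        suffice.\<close>
      unfolding continuous_on_sequentially
    proof (intro allI ballI impI)
      fix u t assume "t \<in> I" and u: "(\<forall>n. u n \<in> I) \<and> u \<longlonglongrightarrow> t"
      then have "limitin euclidean (f \<circ> (\<lambda>n. y (u n))) (f (y t)) sequentially"
        using seq[of u t] by (intro continuous_map_limit[OF f]) auto
      then show "((\<lambda>t. norm (f (y t))) \<circ> u) \<longlonglongrightarrow> norm (f (y t))"
        by (auto simp: o_def intro: tendsto_norm)
    qed
    from continuous_openin_preimage_gen[OF this, of "{a<..}"] show ?thesis
      by (simp add: vimage_def Int_def)
  qed
  \<comment> \<open>The union may be uncountable; it stays Borel because its members are relatively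
    open and not just measurable.\<close>
  then have "openin (top_of_set I)
      (\<Union>f\<in>{f \<in> topological_dual s \<tau>. onorm f \<le> 1}. {t \<in> I. a < norm (f (y t))})"
    by (intro openin_Union) auto
  also have "(\<Union>f\<in>{f \<in> topological_dual s \<tau>. onorm f \<le> 1}. {t \<in> I. a < norm (f (y t))})
      = {t \<in> I. a < norm (y t)}"
    using saks_norm_less_iff[OF s] by auto
  finally obtain U where "open U" "{t \<in> I. a < norm (y t)} = I \<inter> U"
    by (auto simp: openin_open)
  then show "{t \<in> space (restrict_space lborel I). a < norm (y t)} \<in> sets (restrict_space lborel I)"
    by (auto simp: space_restrict_space sets_restrict_space)
qed

section \<open>Integrals over a bounded interval\<close>

lemma set_integrable_bounded_Icc:
  fixes g :: "real \<Rightarrow> real"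
  assumes g: "g \<in> borel_measurable (restrict_space lborel {a..b})"
    and bound: "\<And>t. t \<in> {a..b} \<Longrightarrow> \<bar>g t\<bar> \<le> B"
  shows "set_integrable lborel {a..b} g"
proof -
  have "integrable (restrict_space lborel {a..b}) g"
    using assms by (intro integrableI_bounded_set[where A = "{a..b}" and B = B])
      (auto simp: space_restrict_space sets_restrict_space emeasure_restrict_space
        emeasure_lborel_Icc_eq)
  then show ?thesis
    by (simp add: set_integrable_def integrable_restrict_space)
qed

text \<open>The uniform bound \<open>B\<close> keeps the integrals and the essential supremum
  finite, which excludes the default value \<open>0\<close> of a divergent integral and of
  \<open>real_of_ereal\<close> at infinity. The factor \<open>T + 1\<close> serves all
  \<open>r\<close> at once.\<close>

lemma integral_le_Lr_norm:
  fixes g :: "real \<Rightarrow> real" and r :: ereal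
  assumes T: "T > 0" and r: "r \<ge> 1"
    and g: "g \<in> borel_measurable (restrict_space lborel {0..T})"
    and bound: "\<And>t. t \<in> {0..T} \<Longrightarrow> 0 \<le> g t \<and> g t \<le> B"
  shows "(LINT t:{0..T}|lborel. g t) \<le> (T + 1) *
    (if r = \<infinity> then real_of_ereal (esssup (restrict_space lborel {0..T}) (\<lambda>t. ereal (g t)))
     else (LINT t:{0..T}|lborel. g t powr real_of_ereal r) powr (1 / real_of_ereal r))"
proof (cases "r = \<infinity>")
  case True
  let ?M = "restrict_space lborel {0..T}"
  have space: "space ?M = {0..T}" "emeasure ?M (space ?M) = ennreal T"
    using T by (auto simp: space_restrict_space emeasure_restrict_space)
  have g': "(\<lambda>t. ereal (g t)) \<in> borel_measurable ?M" using g by measurable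
  \<comment> \<open>The interval has positive measure as \<open>T > 0\<close>, so a constant is its
    own essential supremum.\<close>
  have "0 = esssup ?M (\<lambda>_. 0 :: ereal)"
    using T space by (subst esssup_const) (auto simp: ennreal_eq_0_iff)
  also have "\<dots> \<le> esssup ?M (\<lambda>t. ereal (g t))"
    using bound space by (intro esssup_AE_mono AE_I2) auto
  finally have ge: "0 \<le> esssup ?M (\<lambda>t. ereal (g t))" .
  have "esssup ?M (\<lambda>t. ereal (g t)) \<le> ereal B"
    using bound space by (intro esssup_I g' AE_I2) auto
  with ge obtain e where e: "esssup ?M (\<lambda>t. ereal (g t)) = ereal e" "0 \<le> e"
    by (cases "esssup ?M (\<lambda>t. ereal (g t))") auto
  have "AE t in ?M. ereal (g t) \<le> ereal e"
    using esssup_AE[where M = ?M and f = "\<lambda>t. ereal (g t)"] by (simp add: e)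
  moreover have "integrable ?M g"
    using set_integrable_bounded_Icc[OF g, of B] bound
    by (auto simp: set_integrable_def integrable_restrict_space)
  moreover have "finite_measure ?M"
    using space by (intro finite_measureI) auto
  ultimately have "integral\<^sup>L ?M g \<le> integral\<^sup>L ?M (\<lambda>_. e)"
    by (intro integral_mono_AE finite_measure.integrable_const) auto
  also have "\<dots> = T * e"
    using T space by (simp add: measure_def)
  also have "\<dots> \<le> (T + 1) * e" using e by (simp add: algebra_simps)
  finally show ?thesis
    using True by (simp add: e set_lebesgue_integral_def integral_restrict_space)
next
  case False
  then obtain p where p: "r = ereal p" "1 \<le> p"
    using r by (cases r) auto
  let ?L = "LINT t:{0..T}|lborel. g t" and ?G = "LINT t:{0..T}|lborel. g t powr p"
  have int: "set_integrable lborel {0..T} g"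
    using bound by (intro set_integrable_bounded_Icc[OF g, of B]) auto
  have "(\<lambda>t. g t powr p) \<in> borel_measurable (restrict_space lborel {0..T})"
    using g by measurable
  moreover have "\<bar>g t powr p\<bar> \<le> B powr p" if "t \<in> {0..T}" for t
    using bound[OF that] p by (auto intro!: powr_mono2)
  ultimately have int_p: "set_integrable lborel {0..T} (\<lambda>t. g t powr p)"
    by (rule set_integrable_bounded_Icc)
  have const: "set_integrable lborel {0..T} (\<lambda>_. s)" "(LINT t:{0..T}|lborel. s) = T * s" for s :: real
    using T by (auto simp: set_integrable_def set_lebesgue_integral_def)
  \<comment> \<open>This replaces Hoelder's inequality, at the cost of a worse constant.\<close>
  have split: "?L \<le> T * s + s powr (1 - p) * ?G" if s: "0 < s" for s
  proof -
    have "g t \<le> s + s powr (1 - p) * g t powr p" if "t \<in> {0..T}" for t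
    proof (cases "g t \<le> s")
      case True
      then show ?thesis by (simp add: add_increasing2)
    next
      case False
      then have "g t = g t powr (1 - p) * g t powr p"
        using s by (simp add: powr_add[symmetric])
      \<comment> \<open>The exponent \<open>1 - p\<close> is nonpositive and
        \<open>g t > s\<close>.\<close>
      also have "\<dots> \<le> s powr (1 - p) * g t powr p"
        using False s p by (intro mult_right_mono powr_mono2') auto
      finally show ?thesis using s by linarith
    qed
    then have "?L \<le> (LINT t:{0..T}|lborel. s + s powr (1 - p) * g t powr p)"
      by (intro set_integral_mono int set_integral_add(1) const set_integrable_mult_right int_p) auto
    also have "\<dots> = T * s + s powr (1 - p) * ?G"
      by (subst set_integral_add(2)) (auto simp: const int_p)
    finally show ?thesis .
  qed
  have G: "0 \<le> ?G"
    unfolding set_lebesgue_integral_def by (intro integral_nonneg_AE AE_I2) simp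
  have "?L \<le> (T + 1) * ?G powr (1 / p)"
  proof (cases "?G = 0")
    case True
    \<comment> \<open>Here the norm itself is not an admissible \<open>s\<close>, so
      \<open>s\<close> is sent to \<open>0\<close> instead.\<close>
    have "?L \<le> 0 + e" if "0 < e" for e
      using split[of "e / T"] that T True by simp
    then have "?L \<le> 0" by (rule field_le_epsilon)
    then show ?thesis using True by simp
  next
    case False
    \<comment> \<open>Taking the norm for \<open>s\<close> turns the second summand of
      \<open>split\<close> into exactly the norm, whence the factor \<open>T + 1\<close>.\<close>
    have "(?G powr (1 / p)) powr (1 - p) * ?G = ?G powr (1 / p * (1 - p)) * ?G powr 1"
      using G by (simp only: powr_powr powr_one)
    also have "\<dots> = ?G powr (1 / p * (1 - p) + 1)"
      by (simp only: powr_add)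
    also have "1 / p * (1 - p) + 1 = 1 / p"
      using p by (simp add: field_simps)
    finally have "(?G powr (1 / p)) powr (1 - p) * ?G = ?G powr (1 / p)" .
    moreover have "0 < ?G powr (1 / p)"
      using False by simp
    ultimately have "?L \<le> T * ?G powr (1 / p) + ?G powr (1 / p)"
      using split[of "?G powr (1 / p)"] by linarith
    then show ?thesis
      by (simp only: distrib_right mult_1)
  qed
  then show ?thesis using p by simp
qed


section \<open>Semigroup orbits and their observation\<close>

lemma locally_bicontinuous_semigroup_bounded:
  assumes "locally_bicontinuous_semigroup s \<tau> S"
  obtains M where "M \<ge> 1"
    "\<And>t x. t \<in> {0..T} \<Longrightarrow> norm (S t x) \<le> M * norm x"
proof -
  from assms obtain M \<omega> where M: "M \<ge> 1" "\<And>t. t \<ge> 0 \<Longrightarrow> onorm (S t) \<le> M * exp (\<omega> * t)"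
    and op: "\<And>t. t \<ge> 0 \<Longrightarrow> bounded_linear (S t)"
    by (auto simp: locally_bicontinuous_semigroup_def operator_semigroup_def bounded_operators_def)
  show thesis
  proof (rule that)
    \<comment> \<open>The absolute values cover both signs of \<open>\<omega>\<close> and keep the
      constant at least \<open>1\<close> without any assumption on \<open>T\<close>.\<close>
    show "1 \<le> M * exp (\<bar>\<omega>\<bar> * \<bar>T\<bar>)"
      using M(1) mult_mono[of 1 M 1 "exp (\<bar>\<omega>\<bar> * \<bar>T\<bar>)"] by simp
    show "norm (S t x) \<le> M * exp (\<bar>\<omega>\<bar> * \<bar>T\<bar>) * norm x" if "t \<in> {0..T}" for t x
    proof -
      have "norm (S t x) \<le> onorm (S t) * norm x"
        using that by (intro onorm op) auto
      moreover have "onorm (S t) \<le> M * exp (\<omega> * t)"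
        using that by (intro M) auto
      moreover have "\<omega> * t \<le> \<bar>\<omega>\<bar> * \<bar>T\<bar>"
        using that by (intro mult_mono) auto
      then have "M * exp (\<omega> * t) \<le> M * exp (\<bar>\<omega>\<bar> * \<bar>T\<bar>)"
        using M(1) by simp
      ultimately show ?thesis
        by (meson mult_right_mono norm_ge_zero order_trans)
    qed
  qed
qed

text \<open>Orbits are \<tau>X-continuous and norm-bounded on \<open>{0..T}\<close>, so the
  continuity of \<open>C\<close> along bounded sequences carries over to the observed curve in
  \<tau>Y.\<close>

lemma observation_norm_measurable:
  assumes S: "locally_bicontinuous_semigroup s \<tau>X S"
    and Y: "saks_space sY \<tau>Y"
    and C: "seq_continuous_on_bounded \<tau>X \<tau>Y C"
  shows "(\<lambda>t. norm (C (S t x))) \<in> borel_measurable (restrict_space lborel {0..T})"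
proof (rule saks_norm_borel_measurable[OF Y])
  fix u t assume u: "range u \<subseteq> {0..T}" and t: "t \<in> {0..T}" and lim: "u \<longlonglongrightarrow> t"
  have "limitin (top_of_set {0..}) u t sequentially"
    using u t lim by (auto simp: limitin_subtopology image_subset_iff intro!: always_eventually)
  moreover have "continuous_map (top_of_set {0..}) \<tau>X (\<lambda>t. S t x)"
    using S by (simp add: locally_bicontinuous_semigroup_def)
  ultimately have "limitin \<tau>X (\<lambda>n. S (u n) x) (S t x) sequentially"
    using continuous_map_limit by (fastforce simp: o_def)
  moreover have "bounded (range (\<lambda>n. S (u n) x))"
  proof -
    obtain M where "\<And>t x. t \<in> {0..T} \<Longrightarrow> norm (S t x) \<le> M * norm x"
      using locally_bicontinuous_semigroup_bounded[OF S] by metis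
    then show ?thesis
      using u by (intro boundedI[where B = "M * norm x"]) auto
  qed
  ultimately show "limitin \<tau>Y (\<lambda>n. C (S (u n) x)) (C (S t x)) sequentially"
    using C by (simp add: seq_continuous_on_bounded_def)
qed simp

text \<open>Intended for \<open>y = S t x\<close>, its image \<open>z\<close> under
  \<open>P lam\<close>, and \<open>e\<close> the exponential of the uncertainty bound. Split
  \<open>y\<close> into \<open>z\<close> and \<open>y - z\<close>, and \<open>C z\<close> into
  \<open>C y\<close> and \<open>C (y - z)\<close>; \<open>e \<ge> 1\<close> merges the two resulting
  terms in \<open>norm (y - z)\<close>.\<close>

lemma uncertainty_dissipation_estimate:
  fixes C :: "'a::real_normed_vector \<Rightarrow> 'b::real_normed_vector"
  assumes C: "bounded_linear C" and d0: "d0 \<ge> 0" and e: "e \<ge> 1"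
    and unc: "norm z \<le> d0 * e * norm (C z)"
    and diss: "norm (y - z) \<le> d2 * \<epsilon>"
  shows "norm y \<le> d0 * e * norm (C y) + (d0 * onorm C + 1) * d2 * (e * \<epsilon>)"
proof -
  have "norm (C z) \<le> norm (C y) + norm (C (y - z))"
    using norm_triangle_ineq4[of "C y" "C (y - z)"] by (simp add: linear_diff[OF bounded_linear.linear[OF C]])
  also have "norm (C (y - z)) \<le> onorm C * norm (y - z)"
    by (rule onorm[OF C])
  finally have "d0 * e * norm (C z) \<le> d0 * e * (norm (C y) + onorm C * norm (y - z))"
    using d0 e by (intro mult_left_mono) auto
  moreover have "norm y \<le> norm z + norm (y - z)"
    using norm_triangle_ineq[of z "y - z"] by simp
  moreover have "norm (y - z) \<le> e * norm (y - z)"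
    using e by (simp add: mult_left_le mult_le_cancel_right1)
  ultimately have "norm y \<le> d0 * e * norm (C y) + (d0 * onorm C + 1) * (e * norm (y - z))"
    using unc by (simp add: algebra_simps)
  also have "(d0 * onorm C + 1) * (e * norm (y - z)) \<le> (d0 * onorm C + 1) * (e * (d2 * \<epsilon>))"
    using d0 e diss onorm_pos_le[OF C] by (intro mult_left_mono) auto
  finally show ?thesis by (simp add: algebra_simps)
qed

section \<open>Final-state observability of the semigroup\<close>

theorem theorem3p4:
  fixes sX :: "'k::real_normed_field \<Rightarrow> 'a::banach \<Rightarrow> 'a"
    and sY :: "'k \<Rightarrow> 'b::banach \<Rightarrow> 'b"
    and \<tau>X :: "'a topology" and \<tau>Y :: "'b topology"
    and S :: "real \<Rightarrow> 'a \<Rightarrow> 'a" and C :: "'a \<Rightarrow> 'b" and P :: "real \<Rightarrow> 'a \<Rightarrow> 'a"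
    and r :: ereal
    and lam0 d0 d1 d2 d3 \<gamma>1 \<gamma>2 \<gamma>3 T :: real
  assumes "seq_complete_saks_space sX \<tau>X"
    and "locally_bicontinuous_semigroup sX \<tau>X S"
    and "saks_space sY \<tau>Y"
    and "C \<in> bounded_operators sX sY"
    and "seq_continuous_on_bounded \<tau>X \<tau>Y C"
    and "lam0 \<ge> 0"
    and "\<forall>lam>lam0. P lam \<in> bounded_operators sX sX"
    and "r \<ge> 1"
    and "d0 > 0" "d1 > 0" "d3 > 0" "\<gamma>1 > 0" "\<gamma>2 > 0" "\<gamma>3 > 0" "T > 0"
    and "\<gamma>1 < \<gamma>2"
    and "d2 \<ge> 1"
    and "\<forall>x. \<forall>lam>lam0. norm (P lam x) \<le> d0 * exp (d1 * lam powr \<gamma>1) * norm (C (P lam x))"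
    and "\<forall>x. \<forall>lam>lam0. \<forall>t\<in>{0<..T/2}.
           norm (S t x - P lam (S t x)) \<le> d2 * exp (- d3 * lam powr \<gamma>2 * t powr \<gamma>3) * norm x"
  shows "\<exists>C_obs\<ge>0. \<forall>x.
           norm (S T x) \<le>
             (if r = \<infinity>
              then C_obs * real_of_ereal
                     (esssup (restrict_space lborel {0..T}) (\<lambda>t. ereal (norm (C (S t x)))))
              else C_obs *
                     (LINT t:{0..T}|lborel. norm (C (S t x)) powr real_of_ereal r)
                       powr (1 / real_of_ereal r))"
proof -
  note S = assms(2) and unc = assms(18) and diss = assms(19)
  have C: "bounded_linear C"
    using assms(4) by (simp add: bounded_operators_def)
  have S_add: "S (t + u) x = S t (S u x)" if "0 \<le> t" "0 \<le> u" for t u x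
    using S that by (simp add: locally_bicontinuous_semigroup_def operator_semigroup_def)
  obtain M where M: "M \<ge> 1" and bound: "\<And>t x. t \<in> {0..T} \<Longrightarrow> norm (S t x) \<le> M * norm x"
    using locally_bicontinuous_semigroup_bounded[OF S] by metis
  define b where "b = (d0 * onorm C + 1) * d2"
  have b: "1 \<le> b"
    using mult_mono[of 1 "d0 * onorm C + 1" 1 d2] assms(9,17) onorm_pos_le[OF C] by (simp add: b_def)
  have meas: "(\<lambda>t. norm (C (S t x))) \<in> borel_measurable (restrict_space lborel {0..T})" for x
    using observation_norm_measurable[OF S assms(3) assms(5)] .
  have CS: "norm (C (S t x)) \<le> onorm C * (M * norm x)" if "t \<in> {0..T}" for t x
    using onorm[OF C, of "S t x"] mult_left_mono[OF bound[OF that, of x] onorm_pos_le[OF C]]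
    by linarith
  have int: "set_integrable lborel {0..T} (\<lambda>t. norm (C (S t x)))" for x
    using CS by (intro set_integrable_bounded_Icc[OF meas, of _ "onorm C * (M * norm x)"]) auto
  have step: "norm (S (s + t) x) \<le> d0 * exp (d1 * \<mu>) * norm (C (S (s + t) x))
      + b * exp (d1 * \<mu> - d3 * \<mu> powr (\<gamma>2 / \<gamma>1) * t powr \<gamma>3) * norm (S s x)"
    if "0 \<le> s" "0 < t" "t \<le> T / 2" "lam0 powr \<gamma>1 + 1 \<le> \<mu>" for s t \<mu> x
  proof -
    \<comment> \<open>This inverts \<open>\<mu> = lam powr \<gamma>1\<close>. The \<open>+ 1\<close>
      in the threshold for \<open>\<mu>\<close> makes \<open>lam > lam0\<close> strict and
      \<open>\<mu>\<close> positive even for \<open>lam0 = 0\<close>.\<close>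
    define lam where "lam = \<mu> powr (1 / \<gamma>1)"
    have \<mu>: "0 < \<mu>" using that(4) powr_ge_zero[of lam0 \<gamma>1] by linarith
    have lam_powr: "lam powr \<gamma>1 = \<mu>" "lam powr \<gamma>2 = \<mu> powr (\<gamma>2 / \<gamma>1)"
      using \<mu> assms(12) by (auto simp: lam_def powr_powr)
    have "lam0 < lam"
    proof (rule ccontr)
      assume "\<not> lam0 < lam"
      then have "lam powr \<gamma>1 \<le> lam0 powr \<gamma>1"
        using assms(12) by (intro powr_mono2) (auto simp: lam_def)
      then show False using lam_powr(1) that(4) by linarith
    qed
    define \<epsilon> where "\<epsilon> = exp (- d3 * lam powr \<gamma>2 * t powr \<gamma>3) * norm (S s x)"
    have "norm (S t (S s x)) \<le> d0 * exp (d1 * \<mu>) * norm (C (S t (S s x)))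
        + (d0 * onorm C + 1) * d2 * (exp (d1 * \<mu>) * \<epsilon>)"
      using C
    proof (rule uncertainty_dissipation_estimate)
      show "norm (P lam (S t (S s x))) \<le> d0 * exp (d1 * \<mu>) * norm (C (P lam (S t (S s x))))"
        using unc \<open>lam0 < lam\<close> by (simp add: lam_powr(1)[symmetric])
      show "norm (S t (S s x) - P lam (S t (S s x))) \<le> d2 * \<epsilon>"
        using diss[rule_format, OF \<open>lam0 < lam\<close>, of t "S s x"] that
        by (simp add: \<epsilon>_def mult.assoc)
    qed (use assms(9,10) \<mu> in auto)
    moreover have "exp (d1 * \<mu>) * \<epsilon>
        = exp (d1 * \<mu> - d3 * \<mu> powr (\<gamma>2 / \<gamma>1) * t powr \<gamma>3) * norm (S s x)"
      by (simp only: \<epsilon>_def lam_powr mult.assoc[symmetric] exp_add[symmetric]) simp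
    moreover have "S t (S s x) = S (s + t) x"
      using that S_add[of t s x] by (simp add: add.commute)
    ultimately show ?thesis
      by (simp only: b_def mult.assoc)
  qed
  obtain K where K: "K \<ge> 0"
    "\<And>N g. \<lbrakk>\<And>s t. 0 \<le> s \<Longrightarrow> s \<le> t \<Longrightarrow> t \<le> T \<Longrightarrow> N t \<le> M * N s;
        \<And>t. t \<in> {0..T} \<Longrightarrow> 0 \<le> N t; \<And>t. t \<in> {0..T} \<Longrightarrow> 0 \<le> g t; g integrable_on {0..T};
        \<And>s t \<mu>. \<lbrakk>0 \<le> s; 0 < t; t \<le> T / 2; s + t \<le> T; lam0 powr \<gamma>1 + 1 \<le> \<mu>\<rbrakk> \<Longrightarrow>
          N (s + t) \<le> d0 * exp (d1 * \<mu>) * g (s + t)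
            + b * exp (d1 * \<mu> - d3 * \<mu> powr (\<gamma>2 / \<gamma>1) * t powr \<gamma>3) * N s\<rbrakk>
      \<Longrightarrow> N T \<le> K * integral {0..T} g"
    by (rule telescoping_observability[of M d0 b d1 d3 "\<gamma>2 / \<gamma>1" \<gamma>3 T "lam0 powr \<gamma>1 + 1"])
      (use M b assms(9-16) in auto)
  \<comment> \<open>This is the case \<open>r = 1\<close>, with \<open>K\<close> fixed before
    \<open>x\<close>; all other \<open>r\<close> follow by comparing integral norms on
    \<open>{0..T}\<close>.\<close>
  have L1: "norm (S T x) \<le> K * (LINT t:{0..T}|lborel. norm (C (S t x)))" for x
    unfolding set_borel_integral_eq_integral(2)[OF int]
  proof (rule K(2))
    show "norm (S t x) \<le> M * norm (S s x)" if "0 \<le> s" "s \<le> t" "t \<le> T" for s t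
      using bound[of "t - s" "S s x"] S_add[of "t - s" s x] that by simp
  qed (use step set_borel_integral_eq_integral(1)[OF int] in auto)
  show ?thesis
  proof (intro exI conjI allI)
    show "0 \<le> K * (T + 1)" using K(1) assms(15) by simp
    fix x
    have "(LINT t:{0..T}|lborel. norm (C (S t x))) \<le> (T + 1) *
      (if r = \<infinity> then real_of_ereal (esssup (restrict_space lborel {0..T}) (\<lambda>t. ereal (norm (C (S t x)))))
       else (LINT t:{0..T}|lborel. norm (C (S t x)) powr real_of_ereal r) powr (1 / real_of_ereal r))"
      using CS by (intro integral_le_Lr_norm[OF assms(15) assms(8) meas]) auto
    from mult_left_mono[OF this K(1)] L1[of x]
    show "norm (S T x) \<le> (if r = \<infinity>
        then K * (T + 1) * real_of_ereal (esssup (restrict_space lborel {0..T}) (\<lambda>t. ereal (norm (C (S t x)))))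
        else K * (T + 1) * (LINT t:{0..T}|lborel. norm (C (S t x)) powr real_of_ereal r)
          powr (1 / real_of_ereal r))"
      by (cases "r = \<infinity>") (simp_all only: if_True if_False mult.assoc refl)
  qed
qed

end
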